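(* Let $R$ be a commutative ring, $V$ an $R$-module, $E=\mathrm{End}_R(V)$ the ring of $R$-endomorphisms of $V$ (written on the right of their arguments), and let $W$ be a subgroup of $(E,+)$ such that $ab=ba$ for every $a,b\in W$ and $1+a$ is invertible in $E$ for every $a\in W$, where $1\in E$ is the identity endomorphism. Define $Q_{R,V}(W)$ to be the set $W\times V$ with multiplication $$(a,u)(b,v)=(a+b,\;u(1+b)+v(1-a)).$$ Then $Q_{R,V}(W)$ is an automorphic loop.
   Context: Maps are written on the right and composed left to right; for $u\in V$ and $a\in E$, $ua$ is the image of $u$ under $a$. A loop is a set $Q$ with a binary operation such that all translations $L_x: y\mapsto xy$ and $R_x: y\mapsto yx$ are bijections of $Q$ and there is a two-sided identity element $1$. The multiplication group $\mathrm{Mlt}(Q)$ is the permutation group on $Q$ generated by all $L_x,R_x$ with $x\in Q$, and the inner mapping group is $\mathrm{Inn}(Q)=\{\varphi\in \mathrm{Mlt}(Q): 1\varphi=1\}$. A loop $Q$ is automorphic if every element of $\mathrm{Inn}(Q)$ is an automorphism of $Q$. *)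

theory Defs
  imports "HOL-Algebra.Module" "HOL-Algebra.Bij" "HOL-Algebra.Generated_Groups"
begin

section \<open>Automorphic loops\<close>

locale loop =
  fixes Q :: "'a set" and mult :: "'a \<Rightarrow> 'a \<Rightarrow> 'a"  (infixl \<open>\<cdot>\<close> 70)
  assumes mult_closed: "\<lbrakk>x \<in> Q; y \<in> Q\<rbrakk> \<Longrightarrow> x \<cdot> y \<in> Q"
    and bij_left: "x \<in> Q \<Longrightarrow> bij_betw (\<lambda>y. x \<cdot> y) Q Q"
    and bij_right: "x \<in> Q \<Longrightarrow> bij_betw (\<lambda>y. y \<cdot> x) Q Q"
    and ex_ident: "\<exists>e\<in>Q. \<forall>x\<in>Q. e \<cdot> x = x \<and> x \<cdot> e = x"
begin

text \<open>The identity element is unique: for two of them, \<open>e = e \<cdot> e' = e'\<close>.\<close>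

definition ident :: 'a
  where "ident = (THE e. e \<in> Q \<and> (\<forall>x\<in>Q. e \<cdot> x = x \<and> x \<cdot> e = x))"

text \<open>Translations are restricted to \<open>Q\<close>, as the elements of \<^const>\<open>BijGroup\<close> are
  extensional. The order of composition does not affect the generated set.\<close>

definition L :: "'a \<Rightarrow> 'a \<Rightarrow> 'a"
  where "L x = (\<lambda>y\<in>Q. x \<cdot> y)"

definition R :: "'a \<Rightarrow> 'a \<Rightarrow> 'a"
  where "R x = (\<lambda>y\<in>Q. y \<cdot> x)"

definition Mlt :: "('a \<Rightarrow> 'a) set"
  where "Mlt = generate (BijGroup Q) (L ` Q \<union> R ` Q)"

definition Inn :: "('a \<Rightarrow> 'a) set"
  where "Inn = {\<phi> \<in> Mlt. \<phi> ident = ident}"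

definition automorphism :: "('a \<Rightarrow> 'a) \<Rightarrow> bool"
  where "automorphism \<phi> \<longleftrightarrow>
    bij_betw \<phi> Q Q \<and> (\<forall>x\<in>Q. \<forall>y\<in>Q. \<phi> (x \<cdot> y) = \<phi> x \<cdot> \<phi> y)"

end

locale automorphic_loop = loop +
  assumes Inn_automorphism: "\<phi> \<in> Inn \<Longrightarrow> automorphism \<phi>"


section \<open>The endomorphism ring of a module\<close>

text \<open>Endomorphisms are extensional functions on the carrier, so that equality in the ring is
  equality of maps on the module. Maps act on the right: the product \<open>a b\<close> means first \<open>a\<close>,
  then \<open>b\<close>, and the image \<open>u a\<close> is the HOL application \<open>a u\<close>.\<close>

definition module_End :: "('r, 'x) ring_scheme \<Rightarrow> ('r, 'v, 'y) module_scheme \<Rightarrow> ('v \<Rightarrow> 'v) ring"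
  where "module_End R V =
    \<lparr>carrier = {a \<in> extensional (carrier V) \<inter> (carrier V \<rightarrow> carrier V).
       (\<forall>u\<in>carrier V. \<forall>v\<in>carrier V. a (u \<oplus>\<^bsub>V\<^esub> v) = a u \<oplus>\<^bsub>V\<^esub> a v) \<and>
       (\<forall>r\<in>carrier R. \<forall>u\<in>carrier V. a (r \<odot>\<^bsub>V\<^esub> u) = r \<odot>\<^bsub>V\<^esub> a u)},
     mult = \<lambda>a b. compose (carrier V) b a,
     one = \<lambda>u\<in>carrier V. u,
     zero = \<lambda>u\<in>carrier V. \<zero>\<^bsub>V\<^esub>,
     add = \<lambda>a b. \<lambda>u\<in>carrier V. a u \<oplus>\<^bsub>V\<^esub> b u\<rparr>"

lemma ring_module_End:
  assumes "module R V"
  shows "ring (module_End R V)"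
proof -
  interpret module R V by fact
  show ?thesis
  proof (intro ringI abelian_groupI monoidI)
    fix a assume a: "a \<in> carrier (module_End R V)"
    have "(\<lambda>u\<in>carrier V. \<ominus>\<^bsub>V\<^esub> a u) \<in> carrier (module_End R V)"
      using a by (auto simp: module_End_def M.minus_add Pi_iff smult_r_minus)
    moreover have "(\<lambda>u\<in>carrier V. \<ominus>\<^bsub>V\<^esub> a u) \<oplus>\<^bsub>module_End R V\<^esub> a = \<zero>\<^bsub>module_End R V\<^esub>"
      using a by (auto simp: module_End_def M.l_neg Pi_iff restrict_def)
    ultimately show "\<exists>b\<in>carrier (module_End R V). b \<oplus>\<^bsub>module_End R V\<^esub> a = \<zero>\<^bsub>module_End R V\<^esub>"
      by blast
  qed (auto simp: module_End_def Pi_iff compose_def restrict_def fun_eq_iff extensional_def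
      M.a_ac smult_r_distr)
qed


section \<open>The loop multiplication\<close>

text \<open>\<open>(a, u)(b, v) = (a + b, u(1 + b) + v(1 - a))\<close>\<close>

definition Q_mult ::
  "('r, 'x) ring_scheme \<Rightarrow> ('r, 'v, 'y) module_scheme \<Rightarrow>
    ('v \<Rightarrow> 'v) \<times> 'v \<Rightarrow> ('v \<Rightarrow> 'v) \<times> 'v \<Rightarrow> ('v \<Rightarrow> 'v) \<times> 'v"
  where "Q_mult R V = (\<lambda>(a, u) (b, v).
    let E = module_End R V
    in (a \<oplus>\<^bsub>E\<^esub> b, (\<one>\<^bsub>E\<^esub> \<oplus>\<^bsub>E\<^esub> b) u \<oplus>\<^bsub>V\<^esub> (\<one>\<^bsub>E\<^esub> \<ominus>\<^bsub>E\<^esub> a) v))"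

end

theory Submission
  imports Defs
begin

text \<open>
  For fixed \<open>(a, u)\<close> both translations of \<open>Q\<close> are affine in the other argument: they send
  \<open>(b, v)\<close> to \<open>(b + a, u + ub + v(1 - a))\<close> and \<open>(b + a, u - ub + v(1 + a))\<close>. Both are therefore
  of the form \<open>(b, v) \<mapsto> (b + c, w + zb + vp)\<close>,
  with \<open>c\<close> in \<open>W\<close>, vectors \<open>w\<close>, \<open>z\<close>, and a unit \<open>p\<close> of \<open>E\<close> that commutes with every element of
  \<open>W\<close>; for \<open>1 - a\<close> being a unit one uses that \<open>-a\<close> lies in \<open>W\<close>. Because \<open>p\<close> commutes with \<open>W\<close>,
  these maps are closed under composition and under inverses
  (\<open>compose_affine_map\<close>, \<open>affine_map_inverse\<close>). So they form a group of bijections of \<open>W \<times> V\<close>, which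
  contains the translations and hence the whole multiplication group. In particular the
  translations are bijective, and \<open>Q\<close> is a loop with identity \<open>(0, 0)\<close>.

  An inner mapping fixes \<open>(0, 0)\<close>, which forces \<open>c = 0\<close> and \<open>w = 0\<close>. A map
  \<open>(b, v) \<mapsto> (b, zb + vp)\<close> is an automorphism by direct computation: the two terms \<open>zbb'\<close> and
  \<open>-zb'b\<close> that arise in the product of the images of \<open>(b, v)\<close> and \<open>(b', v')\<close> cancel, as \<open>b\<close> and
  \<open>b'\<close> commute.
\<close>

section \<open>Evaluating endomorphisms\<close>

locale commuting_endomorphisms = module R V
  for R :: "('r, 'x) ring_scheme" (structure) and V :: "('r, 'v, 'y) module_scheme" (structure) +
  fixes W :: "('v \<Rightarrow> 'v) set"
  assumes subgroup_W: "subgroup W (add_monoid (module_End R V))"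
    and commute_W: "\<lbrakk>a \<in> W; b \<in> W\<rbrakk> \<Longrightarrow>
      a \<otimes>\<^bsub>module_End R V\<^esub> b = b \<otimes>\<^bsub>module_End R V\<^esub> a"
    and unit_W: "a \<in> W \<Longrightarrow>
      \<one>\<^bsub>module_End R V\<^esub> \<oplus>\<^bsub>module_End R V\<^esub> a \<in> Units (module_End R V)"
begin

abbreviation E :: "('v \<Rightarrow> 'v) ring"
  where "E \<equiv> module_End R V"

abbreviation Q :: "(('v \<Rightarrow> 'v) \<times> 'v) set"
  where "Q \<equiv> W \<times> carrier V"

sublocale E: ring E
  by (rule ring_module_End) unfold_locales

lemma End_closed: "\<lbrakk>a \<in> carrier E; u \<in> carrier V\<rbrakk> \<Longrightarrow> a u \<in> carrier V"
  by (auto simp: module_End_def)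

lemma End_apply_add:
  "\<lbrakk>a \<in> carrier E; u \<in> carrier V; v \<in> carrier V\<rbrakk> \<Longrightarrow> a (u \<oplus>\<^bsub>V\<^esub> v) = a u \<oplus>\<^bsub>V\<^esub> a v"
  by (auto simp: module_End_def)

lemma add_End_apply: "u \<in> carrier V \<Longrightarrow> (a \<oplus>\<^bsub>E\<^esub> b) u = a u \<oplus>\<^bsub>V\<^esub> b u"
  by (auto simp: module_End_def)

lemma mult_End_apply: "u \<in> carrier V \<Longrightarrow> (a \<otimes>\<^bsub>E\<^esub> b) u = b (a u)"
  by (auto simp: module_End_def compose_def)

lemma one_End_apply: "u \<in> carrier V \<Longrightarrow> \<one>\<^bsub>E\<^esub> u = u"
  by (auto simp: module_End_def)

lemma zero_End_apply: "u \<in> carrier V \<Longrightarrow> \<zero>\<^bsub>E\<^esub> u = \<zero>\<^bsub>V\<^esub>"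
  by (auto simp: module_End_def)

lemma minus_End_apply:
  assumes "a \<in> carrier E" "u \<in> carrier V"
  shows "(\<ominus>\<^bsub>E\<^esub> a) u = \<ominus>\<^bsub>V\<^esub> a u"
proof (rule sym, rule M.minus_equality)
  show "(\<ominus>\<^bsub>E\<^esub> a) u \<oplus>\<^bsub>V\<^esub> a u = \<zero>\<^bsub>V\<^esub>"
    using assms by (metis E.l_neg add_End_apply zero_End_apply)
qed (use assms End_closed in auto)

lemma End_apply_zero:
  assumes "a \<in> carrier E" shows "a \<zero>\<^bsub>V\<^esub> = \<zero>\<^bsub>V\<^esub>"
  using End_apply_add[OF assms, of "\<zero>\<^bsub>V\<^esub>" "\<zero>\<^bsub>V\<^esub>"] End_closed[OF assms, of "\<zero>\<^bsub>V\<^esub>"] by simp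

lemma End_apply_minus:
  assumes "a \<in> carrier E" "u \<in> carrier V"
  shows "a (\<ominus>\<^bsub>V\<^esub> u) = \<ominus>\<^bsub>V\<^esub> a u"
proof (rule sym, rule M.minus_equality)
  show "a (\<ominus>\<^bsub>V\<^esub> u) \<oplus>\<^bsub>V\<^esub> a u = \<zero>\<^bsub>V\<^esub>"
    using assms by (metis End_apply_add End_apply_zero M.l_neg M.a_inv_closed)
qed (use assms End_closed in auto)

lemmas End_simps = End_closed End_apply_add End_apply_zero End_apply_minus
  add_End_apply mult_End_apply one_End_apply zero_End_apply minus_End_apply

lemma W_in_E: "a \<in> W \<Longrightarrow> a \<in> carrier E"
  using subgroup.subset[OF subgroup_W] by auto

lemma W_add: "\<lbrakk>a \<in> W; b \<in> W\<rbrakk> \<Longrightarrow> a \<oplus>\<^bsub>E\<^esub> b \<in> W"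
  using subgroup.m_closed[OF subgroup_W] by simp

lemma W_zero: "\<zero>\<^bsub>E\<^esub> \<in> W"
  using subgroup.one_closed[OF subgroup_W] by simp

lemma W_minus: "a \<in> W \<Longrightarrow> \<ominus>\<^bsub>E\<^esub> a \<in> W"
  using subgroup.m_inv_closed[OF subgroup_W] by (simp add: a_inv_def)

lemmas W_simps = W_in_E W_add W_zero W_minus


section \<open>The group of affine maps\<close>

text \<open>The linear parts \<open>p\<close> that the affine maps below may have. The translations of \<open>Q\<close> only
  produce products of elements \<open>1 + a\<close> and their inverses; the full unit group of the centralizer
  of \<open>W\<close> contains these, and membership in it is directly checkable.\<close>

definition C :: "('v \<Rightarrow> 'v) set"
  where "C = {p \<in> Units E. \<forall>a\<in>W. p \<otimes>\<^bsub>E\<^esub> a = a \<otimes>\<^bsub>E\<^esub> p}"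

lemma C_in_E: "p \<in> C \<Longrightarrow> p \<in> carrier E"
  by (auto simp: C_def)

lemma C_one: "\<one>\<^bsub>E\<^esub> \<in> C"
  by (auto simp: C_def W_in_E)

lemma C_mult: "\<lbrakk>p \<in> C; q \<in> C\<rbrakk> \<Longrightarrow> p \<otimes>\<^bsub>E\<^esub> q \<in> C"
  unfolding C_def by (auto simp: W_in_E) (metis E.Units_closed E.m_assoc W_in_E)

lemma C_inv:
  assumes "p \<in> C" shows "inv\<^bsub>E\<^esub> p \<in> C"
proof -
  have "inv\<^bsub>E\<^esub> p \<otimes>\<^bsub>E\<^esub> a = a \<otimes>\<^bsub>E\<^esub> inv\<^bsub>E\<^esub> p" if a: "a \<in> W" for a
  proof -
    let ?q = "inv\<^bsub>E\<^esub> p"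
    have p: "p \<in> Units E" "p \<in> carrier E" "?q \<in> carrier E" "a \<in> carrier E"
      using assms a by (auto simp: C_def W_in_E)
    have "?q \<otimes>\<^bsub>E\<^esub> a = ?q \<otimes>\<^bsub>E\<^esub> (a \<otimes>\<^bsub>E\<^esub> p) \<otimes>\<^bsub>E\<^esub> ?q"
      using p by (simp add: E.m_assoc)
    also have "a \<otimes>\<^bsub>E\<^esub> p = p \<otimes>\<^bsub>E\<^esub> a"
      using assms a by (simp add: C_def)
    also have "?q \<otimes>\<^bsub>E\<^esub> (p \<otimes>\<^bsub>E\<^esub> a) = a"
      using p by (simp flip: E.m_assoc)
    finally show ?thesis .
  qed
  then show ?thesis using assms by (auto simp: C_def)
qed

lemma C_one_plus: "a \<in> W \<Longrightarrow> \<one>\<^bsub>E\<^esub> \<oplus>\<^bsub>E\<^esub> a \<in> C"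
  unfolding C_def using unit_W commute_W by (auto simp: E.l_distr E.r_distr W_in_E)

lemma C_one_minus: "a \<in> W \<Longrightarrow> \<one>\<^bsub>E\<^esub> \<ominus>\<^bsub>E\<^esub> a \<in> C"
  unfolding a_minus_def by (intro C_one_plus W_minus)

lemma W_commute_apply:
  "\<lbrakk>a \<in> W; b \<in> W; u \<in> carrier V\<rbrakk> \<Longrightarrow> a (b u) = b (a u)"
  using commute_W[of a b] by (metis mult_End_apply)

lemma C_commute_apply:
  assumes "p \<in> C" "a \<in> W" "u \<in> carrier V"
  shows "p (a u) = a (p u)"
proof -
  have "(a \<otimes>\<^bsub>E\<^esub> p) u = (p \<otimes>\<^bsub>E\<^esub> a) u"
    using assms by (simp add: C_def)
  then show ?thesis using assms by (simp add: mult_End_apply)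
qed

lemma C_inv_apply:
  assumes "p \<in> C" "u \<in> carrier V"
  shows "(inv\<^bsub>E\<^esub> p) (p u) = u" "p ((inv\<^bsub>E\<^esub> p) u) = u"
proof -
  have "p \<in> Units E" using assms by (simp add: C_def)
  then show "(inv\<^bsub>E\<^esub> p) (p u) = u" "p ((inv\<^bsub>E\<^esub> p) u) = u"
    using assms by (simp_all add: one_End_apply flip: mult_End_apply)
qed

text \<open>The vector \<open>z\<close> measures how the shift in the second component depends on \<open>b\<close>; for a
  translation by \<open>(a, u)\<close> it is \<open>u\<close> or \<open>-u\<close>. The map is restricted to \<open>Q\<close> so that it can be an
  element of \<^const>\<open>BijGroup\<close>.\<close>

definition affine_map :: "('v \<Rightarrow> 'v) \<Rightarrow> 'v \<Rightarrow> 'v \<Rightarrow> ('v \<Rightarrow> 'v) \<Rightarrow> ('v \<Rightarrow> 'v) \<times> 'v \<Rightarrow> ('v \<Rightarrow> 'v) \<times> 'v"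
  where "affine_map c w z p = (\<lambda>(b, v)\<in>Q. (b \<oplus>\<^bsub>E\<^esub> c, w \<oplus>\<^bsub>V\<^esub> b z \<oplus>\<^bsub>V\<^esub> p v))"

definition affine_maps :: "(('v \<Rightarrow> 'v) \<times> 'v \<Rightarrow> ('v \<Rightarrow> 'v) \<times> 'v) set"
  where "affine_maps =
    {affine_map c w z p | c w z p. c \<in> W \<and> w \<in> carrier V \<and> z \<in> carrier V \<and> p \<in> C}"

lemma affine_map_apply:
  "\<lbrakk>b \<in> W; v \<in> carrier V\<rbrakk> \<Longrightarrow>
    affine_map c w z p (b, v) = (b \<oplus>\<^bsub>E\<^esub> c, w \<oplus>\<^bsub>V\<^esub> b z \<oplus>\<^bsub>V\<^esub> p v)"
  by (simp add: affine_map_def)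

lemma affine_map_closed:
  assumes "c \<in> W" "w \<in> carrier V" "z \<in> carrier V" "p \<in> C" "x \<in> Q"
  shows "affine_map c w z p x \<in> Q"
  using assms by (cases x) (auto simp: affine_map_apply W_simps C_in_E End_closed)

lemma affine_maps_closed: "\<lbrakk>f \<in> affine_maps; x \<in> Q\<rbrakk> \<Longrightarrow> f x \<in> Q"
  unfolding affine_maps_def using affine_map_closed by blast

lemma affine_map_id: "affine_map \<zero>\<^bsub>E\<^esub> \<zero>\<^bsub>V\<^esub> \<zero>\<^bsub>V\<^esub> \<one>\<^bsub>E\<^esub> = (\<lambda>x\<in>Q. x)"
  by (rule ext) (auto simp: affine_map_def W_simps End_simps)

text \<open>The coefficient of \<open>b\<close> in the composite again acts as a single vector, since
  \<open>(zb)p' = (zp')b\<close>.\<close>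

lemma compose_affine_map:
  assumes "c \<in> W" "w \<in> carrier V" "z \<in> carrier V" "p \<in> C"
    and "c' \<in> W" "w' \<in> carrier V" "z' \<in> carrier V" "p' \<in> C"
  shows "compose Q (affine_map c' w' z' p') (affine_map c w z p) =
    affine_map (c \<oplus>\<^bsub>E\<^esub> c') (w' \<oplus>\<^bsub>V\<^esub> c z' \<oplus>\<^bsub>V\<^esub> p' w) (z' \<oplus>\<^bsub>V\<^esub> p' z) (p \<otimes>\<^bsub>E\<^esub> p')"
    (is "?l = ?r")
proof
  fix x show "?l x = ?r x"
  proof (cases "x \<in> Q")
    case False
    then show ?thesis by (simp add: compose_def affine_map_def)
  next
    case True
    then obtain b v where x: "x = (b, v)" "b \<in> W" "v \<in> carrier V" by auto
    have cl: "b z \<in> carrier V" "b z' \<in> carrier V" "c z' \<in> carrier V" "p v \<in> carrier V"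
      "p' w \<in> carrier V" "p' z \<in> carrier V" "b (p' z) \<in> carrier V" "p' (p v) \<in> carrier V"
      using x assms by (simp_all add: End_closed W_in_E C_in_E)
    show ?thesis
      using x assms cl
      by (simp add: compose_def affine_map_apply W_simps C_in_E End_simps E.a_assoc
          C_commute_apply M.a_ac)
  qed
qed

lemma affine_map_inverse:
  assumes "c \<in> W" "w \<in> carrier V" "z \<in> carrier V" "p \<in> C"
  obtains g where "g \<in> affine_maps"
    "compose Q g (affine_map c w z p) = (\<lambda>x\<in>Q. x)"
    "compose Q (affine_map c w z p) g = (\<lambda>x\<in>Q. x)"
proof -
  define q where "q = inv\<^bsub>E\<^esub> p"
  have q: "q \<in> C" using assms C_inv by (simp add: q_def)
  have qp: "q (p u) = u" "p (q u) = u" if "u \<in> carrier V" for u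
    using that assms C_inv_apply by (auto simp: q_def)
  have pq: "p \<otimes>\<^bsub>E\<^esub> q = \<one>\<^bsub>E\<^esub>" "q \<otimes>\<^bsub>E\<^esub> p = \<one>\<^bsub>E\<^esub>"
    using assms by (simp_all add: q_def C_def)
  \<comment> \<open>The coefficients come from solving \<open>(b', v') = (b + c, w + zb + vp)\<close> for \<open>(b, v)\<close>.\<close>
  define z' where "z' = \<ominus>\<^bsub>V\<^esub> q z"
  define w' where "w' = c (q z) \<oplus>\<^bsub>V\<^esub> (\<ominus>\<^bsub>V\<^esub> q w)"
  have cl: "z' \<in> carrier V" "w' \<in> carrier V" "q z \<in> carrier V" "q w \<in> carrier V"
      "c (q z) \<in> carrier V" "c z \<in> carrier V" "\<ominus>\<^bsub>E\<^esub> c \<in> W"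
    using assms q by (simp_all add: z'_def w'_def End_closed W_simps C_in_E)
  let ?g = "affine_map (\<ominus>\<^bsub>E\<^esub> c) w' z' q"
  have "w' = (\<ominus>\<^bsub>V\<^esub> q w) \<oplus>\<^bsub>V\<^esub> c (q z)"
    using cl by (simp add: w'_def M.a_comm)
  then have "w' \<oplus>\<^bsub>V\<^esub> c z' \<oplus>\<^bsub>V\<^esub> q w = \<zero>\<^bsub>V\<^esub>"
    using assms cl
    by (simp add: z'_def End_apply_minus W_simps M.a_assoc M.l_neg M.r_neg2)
  moreover have "z' \<oplus>\<^bsub>V\<^esub> q z = \<zero>\<^bsub>V\<^esub>"
    using cl by (simp add: z'_def M.l_neg)
  ultimately have 1: "compose Q ?g (affine_map c w z p) = (\<lambda>x\<in>Q. x)"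
    using assms q cl pq
    by (subst compose_affine_map) (simp_all add: E.r_neg W_in_E affine_map_id)
  have "w \<oplus>\<^bsub>V\<^esub> (\<ominus>\<^bsub>E\<^esub> c) z \<oplus>\<^bsub>V\<^esub> p w' = \<zero>\<^bsub>V\<^esub>"
    using assms q cl
    by (simp add: w'_def End_simps W_simps C_in_E C_commute_apply qp M.a_assoc M.r_neg M.r_neg1)
  moreover have "z \<oplus>\<^bsub>V\<^esub> p z' = \<zero>\<^bsub>V\<^esub>"
    using assms cl by (simp add: z'_def End_simps C_in_E qp M.r_neg)
  ultimately have 2: "compose Q (affine_map c w z p) ?g = (\<lambda>x\<in>Q. x)"
    using assms q cl pq
    by (subst compose_affine_map) (simp_all add: E.l_neg W_in_E affine_map_id)
  have "?g \<in> affine_maps"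
    using q cl by (auto simp: affine_maps_def)
  with 1 2 that show thesis by blast
qed

lemma affine_maps_Bij: "affine_maps \<subseteq> Bij Q"
proof
  fix f assume f_in: "f \<in> affine_maps"
  then obtain c w z p where f: "f = affine_map c w z p"
    and *: "c \<in> W" "w \<in> carrier V" "z \<in> carrier V" "p \<in> C"
    by (auto simp: affine_maps_def)
  obtain g where g: "g \<in> affine_maps"
    "compose Q g f = (\<lambda>x\<in>Q. x)" "compose Q f g = (\<lambda>x\<in>Q. x)"
    using affine_map_inverse[OF *] f by auto
  have "bij_betw f Q Q"
  proof (rule bij_betw_byWitness[where f' = g])
    have "g (f x) = x \<and> f (g x) = x" if "x \<in> Q" for x
      using fun_cong[OF g(2), of x] fun_cong[OF g(3), of x] that
      by (simp add: compose_eq del: mem_Sigma_iff)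
    then show "\<forall>x\<in>Q. g (f x) = x" "\<forall>x\<in>Q. f (g x) = x"
      by blast+
    show "f ` Q \<subseteq> Q" "g ` Q \<subseteq> Q"
      using affine_maps_closed f_in g(1) by blast+
  qed
  moreover have "f \<in> extensional Q"
    by (simp add: f affine_map_def)
  ultimately show "f \<in> Bij Q" by (simp add: Bij_def)
qed

lemma subgroup_affine_maps: "subgroup affine_maps (BijGroup Q)"
proof -
  interpret B: group "BijGroup Q" by (rule group_BijGroup)
  have carrier: "affine_maps \<subseteq> carrier (BijGroup Q)"
    using affine_maps_Bij by (simp add: BijGroup_def)
  have mult: "f \<otimes>\<^bsub>BijGroup Q\<^esub> g = compose Q f g" if "f \<in> affine_maps" "g \<in> affine_maps" for f g
    using that affine_maps_Bij by (auto simp: BijGroup_def)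
  show ?thesis
  proof (rule B.subgroupI)
    show "affine_maps \<noteq> {}"
      using W_zero C_one M.zero_closed unfolding affine_maps_def by blast
  next
    fix f assume f: "f \<in> affine_maps"
    then obtain c w z p where f_eq: "f = affine_map c w z p"
      and *: "c \<in> W" "w \<in> carrier V" "z \<in> carrier V" "p \<in> C"
      by (auto simp: affine_maps_def)
    obtain g where g: "g \<in> affine_maps" "compose Q g f = (\<lambda>x\<in>Q. x)"
      using affine_map_inverse[OF *] f_eq by auto
    then have "g \<otimes>\<^bsub>BijGroup Q\<^esub> f = \<one>\<^bsub>BijGroup Q\<^esub>"
      using mult f by (simp add: BijGroup_def)
    then have "inv\<^bsub>BijGroup Q\<^esub> f = g"
      using f g carrier by (intro B.inv_equality) auto
    with g show "inv\<^bsub>BijGroup Q\<^esub> f \<in> affine_maps" by simp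
  next
    fix f g assume fg: "f \<in> affine_maps" "g \<in> affine_maps"
    then have "compose Q f g \<in> affine_maps"
      unfolding affine_maps_def
      by clarify (subst compose_affine_map; force simp: W_simps C_in_E C_mult End_closed)
    with fg mult show "f \<otimes>\<^bsub>BijGroup Q\<^esub> g \<in> affine_maps" by simp
  qed (rule carrier)
qed


section \<open>Translations and inner mappings\<close>

lemma left_translation_affine:
  assumes "a \<in> W" "u \<in> carrier V"
  shows "(\<lambda>y\<in>Q. Q_mult R V (a, u) y) = affine_map a u u (\<one>\<^bsub>E\<^esub> \<ominus>\<^bsub>E\<^esub> a)"
  using assms
  by (intro ext) (auto simp: affine_map_def Q_mult_def Let_def End_simps W_simps E.a_comm)

lemma right_translation_affine:
  assumes "a \<in> W" "u \<in> carrier V"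
  shows "(\<lambda>y\<in>Q. Q_mult R V y (a, u)) = affine_map a u (\<ominus>\<^bsub>V\<^esub> u) (\<one>\<^bsub>E\<^esub> \<oplus>\<^bsub>E\<^esub> a)"
  using assms
  by (intro ext)
    (auto simp: affine_map_def Q_mult_def a_minus_def End_simps W_simps M.a_ac)

lemma translations_affine:
  assumes "x \<in> Q"
  shows "(\<lambda>y\<in>Q. Q_mult R V x y) \<in> affine_maps" "(\<lambda>y\<in>Q. Q_mult R V y x) \<in> affine_maps"
proof -
  obtain a u where x: "x = (a, u)" "a \<in> W" "u \<in> carrier V" using assms by auto
  show "(\<lambda>y\<in>Q. Q_mult R V x y) \<in> affine_maps"
    using x left_translation_affine[of a u] C_one_minus[of a] by (auto simp: affine_maps_def)
  show "(\<lambda>y\<in>Q. Q_mult R V y x) \<in> affine_maps"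
    using x right_translation_affine[of a u] C_one_plus[of a]
    by (auto simp: affine_maps_def) (use M.a_inv_closed in blast)
qed

lemma identity_Q:
  assumes "x \<in> Q"
  shows "Q_mult R V (\<zero>\<^bsub>E\<^esub>, \<zero>\<^bsub>V\<^esub>) x = x" "Q_mult R V x (\<zero>\<^bsub>E\<^esub>, \<zero>\<^bsub>V\<^esub>) = x"
  using assms by (auto simp: Q_mult_def a_minus_def End_simps W_simps)

lemma loop_Q: "loop Q (Q_mult R V)"
proof
  fix x assume x: "x \<in> Q"
  have "bij_betw (\<lambda>y\<in>Q. Q_mult R V x y) Q Q" "bij_betw (\<lambda>y\<in>Q. Q_mult R V y x) Q Q"
    using translations_affine[OF x] affine_maps_Bij by (auto simp: Bij_def)
  then show left: "bij_betw (\<lambda>y. Q_mult R V x y) Q Q" and "bij_betw (\<lambda>y. Q_mult R V y x) Q Q"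
    by (simp_all add: bij_betw_restrict_eq)
  show "Q_mult R V x y \<in> Q" if "y \<in> Q" for y
    using bij_betw_apply[OF left that] .
next
  show "\<exists>e\<in>Q. \<forall>x\<in>Q. Q_mult R V e x = x \<and> Q_mult R V x e = x"
    using identity_Q W_zero by (intro bexI[of _ "(\<zero>\<^bsub>E\<^esub>, \<zero>\<^bsub>V\<^esub>)"]) auto
qed

text \<open>Expanding \<open>(zb + vp)(1 + b') + (zb' + v'p)(1 - b)\<close>, the terms \<open>zbb'\<close> and \<open>-zb'b\<close> cancel, and
  \<open>p\<close> moves past \<open>1 + b'\<close> and \<open>1 - b\<close>.\<close>

lemma affine_map_fixing_identity_hom:
  assumes z: "z \<in> carrier V" and p: "p \<in> C" and x: "x \<in> Q" and y: "y \<in> Q"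
  defines "\<phi> \<equiv> affine_map \<zero>\<^bsub>E\<^esub> \<zero>\<^bsub>V\<^esub> z p"
  shows "\<phi> (Q_mult R V x y) = Q_mult R V (\<phi> x) (\<phi> y)"
proof -
  obtain b v b' v' where xy: "x = (b, v)" "y = (b', v')"
    "b \<in> W" "b' \<in> W" "v \<in> carrier V" "v' \<in> carrier V"
    using x y by auto
  have cl: "b z \<in> carrier V" "b' z \<in> carrier V" "b (b' z) \<in> carrier V"
    "p v \<in> carrier V" "p v' \<in> carrier V" "b' v \<in> carrier V" "b v' \<in> carrier V"
    "b' (p v) \<in> carrier V" "b (p v') \<in> carrier V"
    using xy z p by (simp_all add: End_closed W_in_E C_in_E)
  have comm: "b' (b z) = b (b' z)"
    using W_commute_apply xy z by simp
  show ?thesis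
    using xy z p cl
    by (simp add: \<phi>_def affine_map_apply Q_mult_def Let_def a_minus_def W_simps C_in_E
        End_simps C_commute_apply comm M.minus_add M.a_ac M.r_neg M.r_neg1 M.r_neg2)
qed

lemma automorphic_loop_Q: "automorphic_loop Q (Q_mult R V)"
proof -
  interpret Q: loop Q "Q_mult R V" by (rule loop_Q)
  have ident: "Q.ident = (\<zero>\<^bsub>E\<^esub>, \<zero>\<^bsub>V\<^esub>)"
    unfolding Q.ident_def
  proof (rule the_equality)
    fix e assume "e \<in> Q \<and> (\<forall>x\<in>Q. Q_mult R V e x = x \<and> Q_mult R V x e = x)"
    then show "e = (\<zero>\<^bsub>E\<^esub>, \<zero>\<^bsub>V\<^esub>)"
      using identity_Q(1)[of e] W_zero by (metis M.zero_closed mem_Sigma_iff)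
  qed (use identity_Q W_zero in auto)
  show ?thesis
  proof
    fix \<phi> assume \<phi>: "\<phi> \<in> Q.Inn"
    have "Q.L ` Q \<union> Q.R ` Q \<subseteq> affine_maps"
      using translations_affine by (auto simp: Q.L_def Q.R_def simp del: mem_Sigma_iff)
    then have "Q.Mlt \<subseteq> affine_maps"
      unfolding Q.Mlt_def
      by (rule group.generate_subgroup_incl[OF group_BijGroup _ subgroup_affine_maps])
    then have affine: "\<phi> \<in> affine_maps" and fixed: "\<phi> (\<zero>\<^bsub>E\<^esub>, \<zero>\<^bsub>V\<^esub>) = (\<zero>\<^bsub>E\<^esub>, \<zero>\<^bsub>V\<^esub>)"
      using \<phi> by (auto simp: Q.Inn_def ident)
    then obtain c w z p where \<phi>_eq: "\<phi> = affine_map c w z p"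
      and *: "c \<in> W" "w \<in> carrier V" "z \<in> carrier V" "p \<in> C"
      by (auto simp: affine_maps_def)
    have "c = \<zero>\<^bsub>E\<^esub>" "w = \<zero>\<^bsub>V\<^esub>"
      using fixed * by (simp_all add: \<phi>_eq affine_map_apply W_simps C_in_E End_simps)
    then show "Q.automorphism \<phi>"
      using affine affine_maps_Bij affine_map_fixing_identity_hom[OF *(3,4)]
      by (auto simp: Q.automorphism_def Bij_def \<phi>_eq simp del: mem_Sigma_iff)
  qed
qed

end

theorem theorem2p2:
  fixes R :: "('r, 'x) ring_scheme" and V :: "('r, 'v, 'y) module_scheme"
    and W :: "('v \<Rightarrow> 'v) set"
  defines "E \<equiv> module_End R V"
  assumes "module R V"
    and "subgroup W (add_monoid E)"
    and "\<And>a b. \<lbrakk>a \<in> W; b \<in> W\<rbrakk> \<Longrightarrow> a \<otimes>\<^bsub>E\<^esub> b = b \<otimes>\<^bsub>E\<^esub> a"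
    and "\<And>a. a \<in> W \<Longrightarrow> \<one>\<^bsub>E\<^esub> \<oplus>\<^bsub>E\<^esub> a \<in> Units E"
  shows "automorphic_loop (W \<times> carrier V) (Q_mult R V)"
proof -
  interpret commuting_endomorphisms R V W
    using assms by (intro commuting_endomorphisms.intro commuting_endomorphisms_axioms.intro) auto
  show ?thesis by (rule automorphic_loop_Q)
qed

end
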